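(* Let $\mathcal{G}=(V,E,w)$ be an undirected weighted graph with edge weights $w:E\to\mathbb{R}_+$. Then the forest edge group centrality $C(S)$ is a monotonically increasing function of the edge set $S$; that is, for any subsets $S\subseteq T\subseteq E$, one has $C(S)\le C(T)$.
   Context: $\mathcal{G}=(V,E,w)$ is a finite undirected graph with $|V|=n$, $|E|=m$, and positive edge weights $w:E\to\mathbb{R}_+$. Its Laplacian is $L=D-A$, where $A$ is the weighted adjacency matrix and $D$ the diagonal (weighted) degree matrix. The forest matrix is $\Omega=(I+L)^{-1}=(\omega_{ij})_{n\times n}$. The forest distance between nodes $i,j$ is $\rho_{ij}=\omega_{ii}+\omega_{jj}-2\omega_{ij}$, and the forest index is $\rho(\mathcal{G})=\sum_{i<j}\rho_{ij}=n\,\mathrm{Tr}(\Omega)-n$. For $S\subseteq E$, $\mathcal{G}-S$ is the weighted graph on the same node set $V$ obtained by deleting the edges in $S$ (weights of the remaining edges unchanged). The forest edge group centrality of $S\subseteq E$ is $C(S)=\rho(\mathcal{G}-S)-\rho(\mathcal{G})$. *)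

theory Defs
  imports "HOL-Analysis.Analysis"
begin

text \<open>
  The node set is the universe of a finite type, an undirected edge is a set of exactly two
  nodes, and the weight function is only relevant on the edge set \<open>E\<close>. Deleting the edges in
  \<open>S\<close> therefore amounts to passing from \<open>(E, w)\<close> to \<open>(E - S, w)\<close>.
\<close>

definition weighted_graph :: "'n::finite set set \<Rightarrow> ('n set \<Rightarrow> real) \<Rightarrow> bool" where
  "weighted_graph E w \<longleftrightarrow> (\<forall>e\<in>E. card e = 2 \<and> 0 < w e)"

definition adjacency_matrix :: "'n::finite set set \<Rightarrow> ('n set \<Rightarrow> real) \<Rightarrow> real^'n^'n" where
  "adjacency_matrix E w = (\<chi> i j. if {i, j} \<in> E then w {i, j} else 0)"

definition weighted_degree :: "'n::finite set set \<Rightarrow> ('n set \<Rightarrow> real) \<Rightarrow> 'n \<Rightarrow> real" where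
  "weighted_degree E w i = (\<Sum>e\<in>{e \<in> E. i \<in> e}. w e)"

definition degree_matrix :: "'n::finite set set \<Rightarrow> ('n set \<Rightarrow> real) \<Rightarrow> real^'n^'n" where
  "degree_matrix E w = (\<chi> i j. if i = j then weighted_degree E w i else 0)"

definition laplacian :: "'n::finite set set \<Rightarrow> ('n set \<Rightarrow> real) \<Rightarrow> real^'n^'n" where
  "laplacian E w = degree_matrix E w - adjacency_matrix E w"

definition forest_matrix :: "'n::finite set set \<Rightarrow> ('n set \<Rightarrow> real) \<Rightarrow> real^'n^'n" where
  "forest_matrix E w = matrix_inv (mat 1 + laplacian E w)"

definition forest_distance :: "'n::finite set set \<Rightarrow> ('n set \<Rightarrow> real) \<Rightarrow> 'n \<Rightarrow> 'n \<Rightarrow> real" where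
  "forest_distance E w i j =
     forest_matrix E w $ i $ i + forest_matrix E w $ j $ j - 2 * forest_matrix E w $ i $ j"

text \<open>
  The forest index sums the forest distance over all unordered pairs of distinct nodes. An arbitrary
  finite type carries no order, so a pair is counted once in each direction and the total is
  halved. This uses symmetry of the forest distance; the lemma \<open>forest_index_ordered\<close> below
  confirms that on ordered nodes the result is the sum over \<open>i < j\<close>.
\<close>

definition forest_index :: "'n::finite set set \<Rightarrow> ('n set \<Rightarrow> real) \<Rightarrow> real" where
  "forest_index E w = (\<Sum>i\<in>UNIV. \<Sum>j\<in>UNIV - {i}. forest_distance E w i j) / 2"

lemma weighted_degree_eq_sum:
  assumes "weighted_graph E w"
  shows "weighted_degree E w i = (\<Sum>j\<in>UNIV. adjacency_matrix E w $ i $ j)"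
proof -
  let ?J = "{j. {i, j} \<in> E}"
  have "bij_betw (\<lambda>j. {i, j}) ?J {e \<in> E. i \<in> e}"
    unfolding bij_betw_def
  proof
    show "inj_on (\<lambda>j. {i, j}) ?J"
      by (auto simp: inj_on_def doubleton_eq_iff)
    show "(\<lambda>j. {i, j}) ` ?J = {e \<in> E. i \<in> e}"
    proof
      show "{e \<in> E. i \<in> e} \<subseteq> (\<lambda>j. {i, j}) ` ?J"
      proof
        fix e assume e: "e \<in> {e \<in> E. i \<in> e}"
        then have "card e = 2" using assms by (auto simp: weighted_graph_def)
        then obtain x y where "e = {x, y}" by (auto simp: card_2_iff)
        then have "e = {i, if i = x then y else x}" using e by auto
        then show "e \<in> (\<lambda>j. {i, j}) ` ?J" using e by blast
      qed
    qed auto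
  qed
  from sum.reindex_bij_betw[OF this, of w]
  have "weighted_degree E w i = (\<Sum>j\<in>?J. w {i, j})"
    by (simp add: weighted_degree_def)
  also have "\<dots> = (\<Sum>j\<in>UNIV. adjacency_matrix E w $ i $ j)"
    by (simp add: adjacency_matrix_def sum.inter_filter[symmetric])
  finally show ?thesis .
qed

lemma one_plus_laplacian_mult:
  assumes "weighted_graph E w"
  shows "((mat 1 + laplacian E w) *v x) $ i =
    x $ i + (\<Sum>j\<in>UNIV. adjacency_matrix E w $ i $ j * (x $ i - x $ j))"
proof -
  have "(degree_matrix E w *v x) $ i = weighted_degree E w i * x $ i"
    by (simp add: degree_matrix_def matrix_vector_mult_def if_distrib[of "\<lambda>c. c * _"] cong: if_cong)
  then show ?thesis
    by (simp add: matrix_vector_mult_add_rdistrib laplacian_def matrix_vector_mult_diff_rdistrib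
        weighted_degree_eq_sum[OF assms] sum_distrib_right right_diff_distrib sum_subtractf)
      (simp add: matrix_vector_mult_def)
qed

lemma kernel_nonpos:
  assumes "weighted_graph E w" and "(mat 1 + laplacian E w) *v x = 0"
  shows "x $ k \<le> 0"
proof -
  obtain i where i: "\<And>j. x $ j \<le> x $ i"
    using Max_in[of "range (\<lambda>j. x $ j)"] Max_ge[of "range (\<lambda>j. x $ j)"] by fastforce
  have "0 \<le> (\<Sum>j\<in>UNIV. adjacency_matrix E w $ i $ j * (x $ i - x $ j))"
    using assms(1) i
    by (intro sum_nonneg mult_nonneg_nonneg)
      (auto simp: adjacency_matrix_def weighted_graph_def less_imp_le)
  moreover have "x $ i + (\<Sum>j\<in>UNIV. adjacency_matrix E w $ i $ j * (x $ i - x $ j)) = 0"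
    using one_plus_laplacian_mult[OF assms(1), of x i] assms(2) by simp
  ultimately show ?thesis using i[of k] by linarith
qed

text \<open>Hence \<open>matrix_inv\<close> in \<open>forest_matrix\<close> is the genuine inverse.\<close>

lemma invertible_one_plus_laplacian:
  assumes "weighted_graph E w"
  shows "invertible (mat 1 + laplacian E w)"
proof -
  have "x = 0" if x: "(mat 1 + laplacian E w) *v x = 0" for x
  proof -
    have "(mat 1 + laplacian E w) *v (- x) = 0"
      using x matrix_vector_mult_diff_distrib[of "mat 1 + laplacian E w" 0 x] by simp
    then have "x $ k = 0" for k
      using kernel_nonpos[OF assms x, of k] kernel_nonpos[OF assms, of "- x" k] by simp
    then show "x = 0" by (simp add: vec_eq_iff)
  qed
  then show ?thesis
    by (simp add: invertible_left_inverse matrix_left_invertible_ker)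
qed

lemma forest_matrix_sym:
  assumes "weighted_graph E w"
  shows "forest_matrix E w $ i $ j = forest_matrix E w $ j $ i"
proof -
  let ?M = "mat 1 + laplacian E w"
  have "transpose ?M = ?M"
    by (auto simp: vec_eq_iff transpose_def laplacian_def degree_matrix_def adjacency_matrix_def
        mat_def insert_commute)
  moreover have *: "?M ** forest_matrix E w = mat 1 \<and> forest_matrix E w ** ?M = mat 1"
    using someI_ex[OF invertible_one_plus_laplacian[OF assms, unfolded invertible_def]]
    unfolding forest_matrix_def matrix_inv_def .
  ultimately have "transpose (forest_matrix E w) ** ?M = mat 1"
    using matrix_transpose_mul[of ?M "forest_matrix E w"] by (simp only: transpose_mat)
  then have "transpose (forest_matrix E w) = forest_matrix E w"
    using * matrix_mul_assoc[of "transpose (forest_matrix E w)" ?M "forest_matrix E w"]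
    by (simp only: matrix_mul_lid matrix_mul_rid)
  then have "transpose (forest_matrix E w) $ i $ j = forest_matrix E w $ i $ j"
    by (simp only:)
  then show ?thesis
    by (simp add: transpose_def)
qed

lemma forest_index_ordered:
  fixes E :: "'n::{finite,linorder} set set"
  assumes "weighted_graph E w"
  shows "forest_index E w = (\<Sum>(i, j)\<in>{(i, j). i < j}. forest_distance E w i j)"
proof -
  let ?f = "\<lambda>(i, j). forest_distance E w i j"
  have "(\<Sum>i\<in>UNIV. \<Sum>j\<in>UNIV - {i}. forest_distance E w i j) =
      sum ?f (SIGMA i:UNIV. UNIV - {i})"
    by (simp add: sum.Sigma)
  also have "(SIGMA i:UNIV. UNIV - {i}) = {(i, j). i < j} \<union> {(i::'n, j). j < i}"
    by auto
  also have "sum ?f \<dots> = sum ?f {(i, j). i < j} + sum ?f {(i, j). j < i}"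
    by (rule sum.union_disjoint) auto
  also have "sum ?f {(i, j). j < i} = sum ?f {(i, j). i < j}"
    by (rule sum.reindex_bij_witness[of _ prod.swap prod.swap])
      (auto simp: forest_distance_def forest_matrix_sym[OF assms])
  finally show ?thesis by (simp add: forest_index_def)
qed

definition forest_edge_group_centrality ::
    "'n::finite set set \<Rightarrow> ('n set \<Rightarrow> real) \<Rightarrow> 'n set set \<Rightarrow> real" where
  "forest_edge_group_centrality E w S = forest_index (E - S) w - forest_index E w"

end

theory Submission
  imports Defs
begin

text \<open>
  Each forest distance is the value of the quadratic form of \<open>(I + L)\<^sup>-\<^sup>1\<close> at a difference of two
  unit vectors. Deleting edges decreases the form \<open>x \<bullet> (I + L) x =
  |x|\<^sup>2 + (\<Sum>i j. a\<^sub>i\<^sub>j (x\<^sub>i - x\<^sub>j)\<^sup>2) / 2\<close>, and inversion reverses the order of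
  positive semidefinite forms, so every single forest distance grows when edges are deleted.
\<close>

lemma matrix_inv_right:
  fixes M :: "'a::semiring_1^'n^'m"
  assumes "invertible M"
  shows "M ** matrix_inv M = mat 1"
  using someI_ex[OF assms[unfolded invertible_def]] unfolding matrix_inv_def by blast

text \<open>With x and y the solutions of \<open>M *v x = b\<close> and \<open>N *v y = b\<close>,
  expanding the form of \<open>N\<close> at x - y gives 0 \<le> x.Nx - 2 x.b + y.b. Bounding x.Nx by
  x.Mx = x.b leaves x.b \<le> y.b.\<close>

lemma matrix_inv_quadratic_form_antimono:
  fixes M N :: "real^'n^'n"
  assumes "invertible M" and "invertible N" and "transpose N = N"
    and nonneg: "\<And>x. 0 \<le> x \<bullet> (N *v x)"
    and le: "\<And>x. x \<bullet> (N *v x) \<le> x \<bullet> (M *v x)"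
  shows "b \<bullet> (matrix_inv M *v b) \<le> b \<bullet> (matrix_inv N *v b)"
proof -
  define x y where "x = matrix_inv M *v b" and "y = matrix_inv N *v b"
  have Mx: "M *v x = b"
    unfolding x_def by (simp add: matrix_vector_mul_assoc matrix_inv_right[OF assms(1)])
  have Ny: "N *v y = b"
    unfolding y_def by (simp add: matrix_vector_mul_assoc matrix_inv_right[OF assms(2)])
  \<comment> \<open>Symmetry of \<open>N\<close> moves it onto y, so both cross terms of the
    expansion equal x.b.\<close>
  have "y \<bullet> (N *v x) = x \<bullet> b"
    using dot_lmul_matrix[of y N x] \<open>transpose N = N\<close> Ny
    by (metis inner_commute transpose_matrix_vector)
  then have "0 \<le> x \<bullet> (N *v x) - 2 * (x \<bullet> b) + y \<bullet> b"
    using nonneg[of "x - y"]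
    by (simp add: matrix_vector_mult_diff_distrib inner_diff_left inner_diff_right Ny)
  also have "x \<bullet> (N *v x) \<le> x \<bullet> b"
    using le[of x] Mx by simp
  finally show ?thesis
    by (simp add: x_def y_def inner_commute)
qed

lemma transpose_one_plus_laplacian:
  "transpose (mat 1 + laplacian E w) = mat 1 + laplacian E w"
  by (auto simp: vec_eq_iff transpose_def laplacian_def degree_matrix_def adjacency_matrix_def
      mat_def insert_commute)

text \<open>Each edge appears as (i, j) and as (j, i), hence the factor 1/2. Written as weighted
  squares, the form can be bounded and compared term by term in the weights.\<close>

lemma one_plus_laplacian_quadratic_form:
  assumes "weighted_graph E w"
  shows "x \<bullet> ((mat 1 + laplacian E w) *v x) =
    x \<bullet> x + (\<Sum>i\<in>UNIV. \<Sum>j\<in>UNIV. adjacency_matrix E w $ i $ j * (x $ i - x $ j)\<^sup>2) / 2"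
proof -
  let ?a = "\<lambda>i j. adjacency_matrix E w $ i $ j"
  let ?s = "\<Sum>i\<in>UNIV. \<Sum>j\<in>UNIV. ?a i j * (x $ i - x $ j) * x $ i"
  have "?s = (\<Sum>i\<in>UNIV. \<Sum>j\<in>UNIV. ?a j i * (x $ j - x $ i) * x $ j)"
    by (rule sum.swap)
  also have "\<dots> = (\<Sum>i\<in>UNIV. \<Sum>j\<in>UNIV. ?a i j * (x $ j - x $ i) * x $ j)"
    by (intro sum.cong refl) (simp add: adjacency_matrix_def insert_commute[of _ _ "{}"])
  \<comment> \<open>Doubling adds \<open>?s\<close> to its copy with i and j exchanged; the two (i,
    j) terms then combine into a square.\<close>
  finally have "2 * ?s = ?s + \<dots>"
    by simp
  also have "\<dots> = (\<Sum>i\<in>UNIV. \<Sum>j\<in>UNIV. ?a i j * (x $ i - x $ j)\<^sup>2)"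
    unfolding sum.distrib[symmetric]
    by (intro sum.cong refl) (simp add: power2_eq_square algebra_simps)
  finally have "?s = (\<Sum>i\<in>UNIV. \<Sum>j\<in>UNIV. ?a i j * (x $ i - x $ j)\<^sup>2) / 2"
    by simp
  moreover have "x \<bullet> ((mat 1 + laplacian E w) *v x) = x \<bullet> x + ?s"
    unfolding inner_vec_def one_plus_laplacian_mult[OF assms] sum.distrib[symmetric]
    by (intro sum.cong refl) (simp add: distrib_left sum_distrib_left mult_ac)
  ultimately show ?thesis by simp
qed

lemma weighted_graph_subset:
  "weighted_graph E w \<Longrightarrow> F \<subseteq> E \<Longrightarrow> weighted_graph F w"
  by (auto simp: weighted_graph_def)

lemma adjacency_matrix_nonneg:
  "weighted_graph E w \<Longrightarrow> 0 \<le> adjacency_matrix E w $ i $ j"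
  by (auto simp: adjacency_matrix_def weighted_graph_def less_imp_le)

lemma adjacency_matrix_mono:
  "weighted_graph E w \<Longrightarrow> F \<subseteq> E \<Longrightarrow> adjacency_matrix F w $ i $ j \<le> adjacency_matrix E w $ i $ j"
  by (auto simp: adjacency_matrix_def weighted_graph_def less_imp_le)

text \<open>Expanding the form yields both off-diagonal entries (i, j) and (j, i); symmetry of the
  forest matrix merges them into the term with factor 2.\<close>

lemma forest_distance_eq_quadratic_form:
  assumes "weighted_graph E w"
  shows "forest_distance E w i j =
    (axis i 1 - axis j 1) \<bullet> (forest_matrix E w *v (axis i 1 - axis j 1))"
  using forest_matrix_sym[OF assms, of i j]
  by (simp add: forest_distance_def matrix_vector_mult_diff_distrib inner_diff_left
      inner_axis' matrix_vector_mult_basis column_def)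

lemma forest_distance_antimono:
  assumes E: "weighted_graph E w" and "F \<subseteq> E"
  shows "forest_distance E w i j \<le> forest_distance F w i j"
proof -
  have F: "weighted_graph F w"
    using assms by (rule weighted_graph_subset)
  show ?thesis
    unfolding forest_distance_eq_quadratic_form[OF E] forest_distance_eq_quadratic_form[OF F]
      forest_matrix_def
  \<comment> \<open>The larger form \<open>M\<close> comes from \<open>E\<close>, the smaller form
    \<open>N\<close> from \<open>F\<close>.\<close>
  proof (rule matrix_inv_quadratic_form_antimono)
    fix x :: "real^'a"
    show "0 \<le> x \<bullet> ((mat 1 + laplacian F w) *v x)"
      unfolding one_plus_laplacian_quadratic_form[OF F]
      by (intro add_nonneg_nonneg divide_nonneg_pos sum_nonneg mult_nonneg_nonneg
          adjacency_matrix_nonneg[OF F]) auto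
    show "x \<bullet> ((mat 1 + laplacian F w) *v x) \<le> x \<bullet> ((mat 1 + laplacian E w) *v x)"
      unfolding one_plus_laplacian_quadratic_form[OF F] one_plus_laplacian_quadratic_form[OF E]
      by (intro add_left_mono divide_right_mono sum_mono mult_right_mono
          adjacency_matrix_mono[OF assms]) auto
  qed (simp_all add: invertible_one_plus_laplacian E F transpose_one_plus_laplacian)
qed

lemma forest_index_antimono:
  assumes "weighted_graph E w" and "F \<subseteq> E"
  shows "forest_index E w \<le> forest_index F w"
  unfolding forest_index_def
  by (intro divide_right_mono sum_mono forest_distance_antimono assms) simp

theorem proposition1:
  fixes E S T :: "'n::finite set set" and w :: "'n set \<Rightarrow> real"
  assumes "weighted_graph E w"
    and "S \<subseteq> T" and "T \<subseteq> E"
  shows "forest_edge_group_centrality E w S \<le> forest_edge_group_centrality E w T"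
proof -
  have "weighted_graph (E - S) w"
    using assms(1) by (rule weighted_graph_subset) blast
  \<comment> \<open>Deleting more leaves fewer edges, so this inclusion and the antimonotone index
    reverse the order twice.\<close>
  moreover have "E - T \<subseteq> E - S"
    using assms(2) by blast
  ultimately show ?thesis
    unfolding forest_edge_group_centrality_def
    by (intro diff_right_mono forest_index_antimono)
qed

end
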